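(* Let $L\subset\mathbb{C}^3$ be a $1$-dimensional isotropic subspace with $QL\neq L$ and let $\alpha\in\mathbb{C}\setminus\{0\}$. Set $L_1=L$, $L_2=\overline{L}$, $\alpha_1=\alpha$, $\alpha_2=\frac{1}{\overline{\alpha_1}}$, and assume $\alpha_1^2\neq\alpha_2^2$ (so that $|\alpha|\ne 1$). Set $L_2'=p_{\alpha_1,L_1}(\alpha_2)L_2$ and $L_1'=p_{\alpha_2,L_2}(\alpha_1)L_1$, and assume $QL_i'\neq L_i'$ for $i=1,2$. Then there exists $k\in (K^\tau)^{\mathbb{C}}$ such that $k\,p_{\alpha_2,L_2'}\,p_{\alpha_1,L_1}\in\Lambda_{I,B}^\varepsilon\mathrm{SO}(3,\mathbb{R})$ for some $0<\varepsilon<1$.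
   Context: $\mathbb{C}^3=(\mathbb{R}^3)^{\mathbb{C}}$ carries the complex bilinear extension $(\cdot,\cdot)$ of the standard inner product; a subspace $L$ is isotropic if $(L,L)=0$. $Q=\mathrm{diag}(1,-1,-1)$, $\tau$ is conjugation by $Q$ on $\mathrm{SO}(3,\mathbb{C})$, $K^\tau$ is the fixed set of $\tau$ in $\mathrm{SO}(3,\mathbb{R})$, and $(K^\tau)^{\mathbb{C}}$ is its complexification (the fixed set of $\tau$ in $\mathrm{SO}(3,\mathbb{C})$). $K\cong\mathrm{SO}(2)$ is the identity component of $K^\tau$, i.e. the stabilizer of $e_1$; $K^{\mathbb{C}}=KB$ is a fixed Iwasawa decomposition with $B$ a solvable subgroup (here $K^{\mathbb{C}}\cong\mathbb{C}^*$ and $B\cong\mathbb{R}^+$). Simple factor: for $\alpha\in\mathbb{C}\setminus\{0\}$ and $L$ a $1$-dimensional isotropic subspace with $QL\neq L$, let $L_0=(L\oplus QL)^\perp$, let $\pi_L,\pi_{L_0},\pi_{QL}$ be the projections for $\mathbb{C}^3=L\oplus L_0\oplus QL$, and $$p_{\alpha,L}(\lambda)=\frac{\alpha-\lambda}{\alpha+\lambda}\pi_L+\pi_{L_0}+\frac{\alpha+\lambda}{\alpha-\lambda}\pi_{QL},\qquad\lambda\in\mathbb{P}^1\setminus\{\pm\alpha\}.$$ For $0<\varepsilon<1$ let $C^\varepsilon$ be the union of the circles of radius $\varepsilon$ and $1/\varepsilon$ centred at $0$, and $I^\varepsilon=\{\lambda\in\mathbb{P}^1:|\lambda|<\varepsilon\text{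 or }|\lambda|>1/\varepsilon\}$. $\Lambda_{I,B}^\varepsilon\mathrm{SO}(3,\mathbb{C})$ is the group of smooth maps $\gamma:C^\varepsilon\to\mathrm{SO}(3,\mathbb{C})$ with $\tau\gamma(\lambda)=\gamma(-\lambda)$ that extend holomorphically to $\gamma:I^\varepsilon\to\mathrm{SO}(3,\mathbb{C})$ with $\gamma(0)\in B$; $\Lambda_{I,B}^\varepsilon\mathrm{SO}(3,\mathbb{R})$ is the subgroup of those satisfying the reality condition $\gamma(\lambda)=\overline{\gamma(1/\overline{\lambda})}$. *)

theory Defs
  imports "HOL-Analysis.Analysis" "HOL-Algebra.Solvable_Groups"
begin

section \<open>Linear algebra on complex three-space\<close>

definition cbil :: "complex^3 \<Rightarrow> complex^3 \<Rightarrow> complex" where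
  "cbil v w = (\<Sum>i\<in>UNIV. v $ i * w $ i)"

definition isotropic :: "(complex^3) set \<Rightarrow> bool" where
  "isotropic L \<longleftrightarrow> (\<forall>v\<in>L. \<forall>w\<in>L. cbil v w = 0)"

definition isotropic_line :: "(complex^3) set \<Rightarrow> bool" where
  "isotropic_line L \<longleftrightarrow> vec.subspace L \<and> vec.dim L = 1 \<and> isotropic L"

definition bil_perp :: "(complex^3) set \<Rightarrow> (complex^3) set" where
  "bil_perp S = {v. \<forall>w\<in>S. cbil v w = 0}"

definition subspace_sum :: "(complex^3) set \<Rightarrow> (complex^3) set \<Rightarrow> (complex^3) set" where
  "subspace_sum U W = {u + w | u w. u \<in> U \<and> w \<in> W}"

text \<open>The projection onto \<open>U\<close> along \<open>W\<close>; meaningful when the space is the direct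
  sum of \<open>U\<close> and \<open>W\<close>.\<close>

definition proj_along :: "(complex^3) set \<Rightarrow> (complex^3) set \<Rightarrow> complex^3^3" where
  "proj_along U W = matrix (\<lambda>v. THE u. u \<in> U \<and> v - u \<in> W)"

definition conj_vec :: "complex^3 \<Rightarrow> complex^3" where
  "conj_vec v = (\<chi> i. cnj (v $ i))"

definition conj_mat :: "complex^3^3 \<Rightarrow> complex^3^3" where
  "conj_mat A = map_matrix cnj A"

definition Q_mat :: "complex^3^3" where
  "Q_mat = (\<chi> i j. if i = j then (if i = 1 then 1 else - 1) else 0)"

abbreviation mat_image :: "complex^3^3 \<Rightarrow> (complex^3) set \<Rightarrow> (complex^3) set" where
  "mat_image A L \<equiv> (\<lambda>v. A *v v) ` L"


section \<open>The groups\<close>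

definition SO3C :: "(complex^3^3) set" where
  "SO3C = {A. orthogonal_matrix A \<and> det A = 1}"

definition SO3R :: "(complex^3^3) set" where
  "SO3R = {A \<in> SO3C. \<forall>i j. A $ i $ j \<in> \<real>}"

text \<open>Conjugation by \<open>Q\<close>; note that \<open>Q\<close> is its own inverse.\<close>

definition tau :: "complex^3^3 \<Rightarrow> complex^3^3" where
  "tau A = Q_mat ** A ** Q_mat"

definition Ktau :: "(complex^3^3) set" where
  "Ktau = {A \<in> SO3R. tau A = A}"

definition KtauC :: "(complex^3^3) set" where
  "KtauC = {A \<in> SO3C. tau A = A}"

text \<open>\<open>K\<close> and its complexification, as stabilizers of the first basis vector; that these
  are the identity components of \<open>Ktau\<close> and \<open>KtauC\<close> is proved below.\<close>

definition K_grp :: "(complex^3^3) set" where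
  "K_grp = {A \<in> SO3R. A *v axis 1 1 = axis 1 1}"

definition KC_grp :: "(complex^3^3) set" where
  "KC_grp = {A \<in> SO3C. A *v axis 1 1 = axis 1 1}"

lemma KtauC_corner: "A \<in> KtauC \<Longrightarrow> A $ 1 $ 1 = 1 \<or> A $ 1 $ 1 = -1"
  and KtauC_stab: "A \<in> KtauC \<Longrightarrow> A $ 1 $ 1 = 1 \<Longrightarrow> A *v axis 1 1 = axis 1 1"
proof -
  assume A: "A \<in> KtauC"
  have t: "\<And>i j. (Q_mat ** A ** Q_mat) $ i $ j = A $ i $ j"
    using A by (simp add: KtauC_def tau_def)
  have z: "A $ 2 $ 1 = 0" "A $ 3 $ 1 = 0"
    using t[of 2 1] t[of 3 1] by (simp_all add: Q_mat_def matrix_matrix_mult_def sum_3)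
  have "(transpose A ** A) $ 1 $ 1 = (mat 1 :: complex^3^3) $ 1 $ 1"
    using A unfolding KtauC_def SO3C_def orthogonal_matrix_def by auto
  then have "(A $ 1 $ 1)\<^sup>2 = 1"
    using z by (simp add: matrix_matrix_mult_def transpose_def sum_3 mat_def power2_eq_square)
  then show "A $ 1 $ 1 = 1 \<or> A $ 1 $ 1 = -1" by (simp add: power2_eq_1_iff)
  assume "A $ 1 $ 1 = 1"
  then show "A *v axis 1 1 = axis 1 1"
    using z by (simp add: vec_eq_iff matrix_vector_mult_def sum_3 axis_def forall_3)
qed

lemma component_stab:
  assumes S: "S \<subseteq> KtauC" and A: "A \<in> connected_component_set S (mat 1)"
  shows "A *v axis 1 1 = axis 1 1"
proof -
  define T where "T = connected_component_set S (mat 1)"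
  have TS: "T \<subseteq> KtauC" using S connected_component_subset unfolding T_def by blast
  have one: "mat 1 \<in> T" using A unfolding T_def
    by (metis connected_component_eq_empty connected_component_refl emptyE mem_Collect_eq)
  have c: "connected ((\<lambda>A. A $ 1 $ 1) ` T)"
    unfolding T_def by (intro connected_continuous_image continuous_intros connected_connected_component)
  have "(\<lambda>A. A $ 1 $ 1) ` T \<subseteq> {1, - 1}" using TS KtauC_corner by blast
  then have "finite ((\<lambda>A. A $ 1 $ 1) ` T)" using finite_subset by blast
  then have "(\<lambda>A. A $ 1 $ 1) ` T = {} \<or> (\<exists>a. (\<lambda>A. A $ 1 $ 1) ` T = {a})"
    using connected_finite_iff_sing[OF c] by simp
  then obtain a where a: "(\<lambda>A. A $ 1 $ 1) ` T = {a}" using one by auto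
  have "(mat 1 :: complex^3^3) $ 1 $ 1 = 1" by (simp add: mat_def)
  with a one have "a = 1" by force
  with a A have "A $ 1 $ 1 = 1" unfolding T_def by blast
  then show ?thesis using KtauC_stab TS A unfolding T_def by blast
qed

definition rot :: "complex \<Rightarrow> complex^3^3" where
  "rot z = vector [vector [1, 0, 0], vector [0, cos z, - sin z], vector [0, sin z, cos z]]"

lemma rot_KC: "rot z \<in> KC_grp \<inter> KtauC"
proof -
  have sc: "cos z * cos z + sin z * sin z = 1" "sin z * sin z + cos z * cos z = 1"
    using sin_cos_squared_add[of z] by (simp_all add: power2_eq_square add.commute)
  have "orthogonal_matrix (rot z)"
    unfolding orthogonal_matrix_def
    by (simp add: rot_def matrix_matrix_mult_def transpose_def sum_3 vec_eq_iff forall_3 mat_def sc)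
  moreover have "det (rot z) = 1" by (simp add: rot_def det_3 sc)
  moreover have "tau (rot z) = rot z"
    by (simp add: rot_def tau_def Q_mat_def matrix_matrix_mult_def sum_3 vec_eq_iff forall_3)
  moreover have "rot z *v axis 1 1 = axis 1 1"
    by (simp add: rot_def matrix_vector_mult_def sum_3 vec_eq_iff forall_3 axis_def)
  ultimately show ?thesis by (simp add: KC_grp_def KtauC_def SO3C_def)
qed

lemma KC_rot: assumes A: "A \<in> KC_grp" shows "\<exists>z. A = rot z \<and> (A \<in> SO3R \<longrightarrow> z \<in> \<real>)"
proof -
  have s: "\<And>i. (A *v axis 1 1) $ i = axis 1 1 $ i" using A by (simp add: KC_grp_def)
  have c1: "A $ 1 $ 1 = 1" "A $ 2 $ 1 = 0" "A $ 3 $ 1 = 0"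
    using s[of 1] s[of 2] s[of 3] by (simp_all add: matrix_vector_mult_def sum_3 axis_def)
  have o: "\<And>i j. (transpose A ** A) $ i $ j = mat 1 $ i $ j" and d: "det A = 1"
    using A by (simp_all add: KC_grp_def SO3C_def orthogonal_matrix_def)
  have r1: "A $ 1 $ 2 = 0" "A $ 1 $ 3 = 0"
    using o[of 1 2] o[of 1 3] c1 by (simp_all add: matrix_matrix_mult_def transpose_def sum_3 mat_def)
  define a b c e where "a = A $ 2 $ 2" "b = A $ 3 $ 2" "c = A $ 2 $ 3" "e = A $ 3 $ 3"
  have e1: "a * a + b * b = 1" "a * c + b * e = 0" "c * c + e * e = 1"
    using o[of 2 2] o[of 2 3] o[of 3 3] c1 r1
    by (simp_all add: a_b_c_e_def matrix_matrix_mult_def transpose_def sum_3 mat_def)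
  have e2: "a * e - b * c = 1" using d c1 r1 by (simp add: det_3 a_b_c_e_def mult.commute)
  have ce: "e = a" "c = - b" using e1 e2 by algebra+
  have rot: "A = rot z" if "cos z = a" "sin z = b" for z
    using that c1 r1 ce by (simp add: rot_def vec_eq_iff forall_3 a_b_c_e_def)
  show ?thesis
  proof (cases "A \<in> SO3R")
    case True
    then have "a \<in> \<real>" "b \<in> \<real>" by (simp_all add: SO3R_def a_b_c_e_def)
    then obtain x y where xy: "a = of_real x" "b = of_real y" unfolding Reals_def by blast
    have "complex_of_real (x\<^sup>2 + y\<^sup>2) = of_real 1" using e1(1) xy by (simp add: power2_eq_square)
    then have "x\<^sup>2 + y\<^sup>2 = 1" by (simp only: of_real_eq_iff)
    then obtain t where "x = cos t" "y = sin t" using sincos_total_2pi by metis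
    then have "A = rot (of_real t)" using rot[of "of_real t"] xy by (simp add: cos_of_real sin_of_real)
    then show ?thesis using Reals_of_real by metis
  next
    case False
    have "(sin (Arccos a))\<^sup>2 = b\<^sup>2"
      using e1(1) sin_squared_eq[of "Arccos a"] by (simp add: power2_eq_square) (metis add_diff_cancel_left')
    then have "sin (Arccos a) = b \<or> sin (- Arccos a) = b" by (auto simp: power2_eq_iff)
    then have "\<exists>z. A = rot z" using rot[of "Arccos a"] rot[of "- Arccos a"] by auto
    with False show ?thesis by blast
  qed
qed

lemma cont_rot: "continuous_on S rot"
proof -
  have "rot = (\<lambda>z. \<chi> i j. rot z $ i $ j)" by (simp add: fun_eq_iff vec_eq_iff)
  moreover have c: "continuous_on S (\<lambda>z. rot z $ i $ j)" for i j
    using exhaust_3[of i] exhaust_3[of j]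
    by (elim disjE) (simp_all add: rot_def continuous_on_sin continuous_on_cos continuous_on_minus)
  have "continuous_on S (\<lambda>z. \<chi> i j. rot z $ i $ j)"
    by (intro continuous_on_vec_lambda c)
  ultimately show ?thesis by simp
qed

lemma rot_0: "rot 0 = mat 1" by (simp add: rot_def vec_eq_iff forall_3 mat_def)

lemma KC_grp_identity_component: "KC_grp = connected_component_set KtauC (mat 1)"
proof
  have "rot ` UNIV \<subseteq> connected_component_set KtauC (mat 1)"
    using rot_KC rot_0 by (intro connected_component_maximal connected_continuous_image cont_rot)
      (auto intro!: image_eqI[of _ _ 0])
  then show "KC_grp \<subseteq> connected_component_set KtauC (mat 1)" using KC_rot by blast
  show "connected_component_set KtauC (mat 1) \<subseteq> KC_grp"
    using component_stab[of KtauC] connected_component_subset[of KtauC "mat 1"]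
    unfolding KC_grp_def KtauC_def by auto
qed

lemma K_grp_identity_component: "K_grp = connected_component_set Ktau (mat 1)"
proof
  have sub: "Ktau \<subseteq> KtauC" by (auto simp: Ktau_def KtauC_def SO3R_def)
  have re: "rot z $ i $ j \<in> \<real>" if zr: "z \<in> \<real>" for z i j
  proof -
    obtain x where "z = complex_of_real x" using zr by (rule Reals_cases)
    then show ?thesis using exhaust_3[of i] exhaust_3[of j]
      by (auto simp: rot_def cos_of_real sin_of_real)
  qed
  have Kt: "rot z \<in> Ktau" if "z \<in> \<real>" for z
    using rot_KC[of z] re[OF that] by (simp add: Ktau_def KtauC_def SO3R_def)
  have "connected (range complex_of_real)"
    by (intro connected_continuous_image continuous_intros) auto
  then have "connected (rot ` \<real>)"
    by (intro connected_continuous_image cont_rot) (simp add: Reals_def)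
  then have "rot ` \<real> \<subseteq> connected_component_set Ktau (mat 1)"
    using Kt rot_0 by (intro connected_component_maximal) (auto intro!: image_eqI[of _ _ 0])
  then show "K_grp \<subseteq> connected_component_set Ktau (mat 1)"
    using KC_rot unfolding K_grp_def KC_grp_def SO3R_def by fast
  show "connected_component_set Ktau (mat 1) \<subseteq> K_grp"
    using component_stab[OF sub] connected_component_subset[of Ktau "mat 1"]
    unfolding K_grp_def Ktau_def by auto
qed

definition mat_group :: "(complex^3^3) set \<Rightarrow> (complex^3^3) monoid" where
  "mat_group S = \<lparr>carrier = S, mult = (**), one = mat 1\<rparr>"

text \<open>\<open>KC_grp = K_grp B\<close> is an Iwasawa decomposition: \<open>B\<close> is a solvable subgroup and
  multiplication is a homeomorphism from \<open>K_grp \<times> B\<close> onto \<open>KC_grp\<close>.\<close>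

definition iwasawa :: "(complex^3^3) set \<Rightarrow> bool" where
  "iwasawa B \<longleftrightarrow>
     subgroup B (mat_group KC_grp) \<and> solvable (mat_group B) \<and>
     (\<exists>g. homeomorphism (K_grp \<times> B) KC_grp (\<lambda>(k, b). k ** b) g)"


section \<open>Simple factors\<close>

datatype cp1 = Fin complex | Infty

text \<open>At \<open>\<infinity>\<close> both \<open>(\<alpha> - z) / (\<alpha> + z)\<close> and its inverse take the value \<open>-1\<close>.
  At the excluded points \<open>z = \<plusminus>\<alpha>\<close> the values of \<open>simple_factor\<close> are meaningless.\<close>

fun moebius :: "complex \<Rightarrow> cp1 \<Rightarrow> complex" where
  "moebius \<alpha> (Fin z) = (\<alpha> - z) / (\<alpha> + z)"
| "moebius \<alpha> Infty = - 1"

definition simple_factor :: "complex \<Rightarrow> (complex^3) set \<Rightarrow> cp1 \<Rightarrow> complex^3^3" where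
  "simple_factor \<alpha> L p =
     (let QL = mat_image Q_mat L;
          L0 = bil_perp (subspace_sum L QL);
          piL = proj_along L (subspace_sum L0 QL);
          piL0 = proj_along L0 (subspace_sum L QL);
          piQL = proj_along QL (subspace_sum L L0)
      in map_matrix ((*) (moebius \<alpha> p)) piL + piL0 +
         map_matrix ((*) (inverse (moebius \<alpha> p))) piQL)"


section \<open>Loop groups\<close>

definition circles :: "real \<Rightarrow> complex set" where
  "circles \<epsilon> = {z. norm z = \<epsilon> \<or> norm z = 1 / \<epsilon>}"

definition I_dom :: "real \<Rightarrow> cp1 set" where
  "I_dom \<epsilon> = insert Infty (Fin ` {z. norm z < \<epsilon> \<or> norm z > 1 / \<epsilon>})"

text \<open>The chart at \<open>\<infinity>\<close> with coordinate \<open>w = 1 / z\<close>.  Analytic notions on subsets of the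
  projective line are tested in the two standard charts.\<close>

definition chart_inf :: "complex \<Rightarrow> cp1" where
  "chart_inf w = (if w = 0 then Infty else Fin (1 / w))"

definition cp1_continuous_on :: "cp1 set \<Rightarrow> (cp1 \<Rightarrow> complex^3^3) \<Rightarrow> bool" where
  "cp1_continuous_on S f \<longleftrightarrow>
     continuous_on (Fin -` S) (f \<circ> Fin) \<and> continuous_on (chart_inf -` S) (f \<circ> chart_inf)"

definition cp1_holomorphic_on :: "cp1 set \<Rightarrow> (cp1 \<Rightarrow> complex^3^3) \<Rightarrow> bool" where
  "cp1_holomorphic_on S f \<longleftrightarrow>
     (\<forall>i j. (\<lambda>z. f (Fin z) $ i $ j) holomorphic_on (Fin -` S) \<and>
            (\<lambda>w. f (chart_inf w) $ i $ j) holomorphic_on (chart_inf -` S))"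

text \<open>\<open>D n\<close> is the \<open>n\<close>-th derivative of \<open>f\<close>.\<close>

definition smooth_curve :: "(real \<Rightarrow> complex^3^3) \<Rightarrow> bool" where
  "smooth_curve f \<longleftrightarrow>
     (\<exists>D. D 0 = f \<and> (\<forall>n t. (D n has_vector_derivative D (Suc n) t) (at t)))"

definition smooth_on_circles :: "real \<Rightarrow> (complex \<Rightarrow> complex^3^3) \<Rightarrow> bool" where
  "smooth_on_circles \<epsilon> \<gamma> \<longleftrightarrow>
     (\<forall>r\<in>{\<epsilon>, 1 / \<epsilon>}. smooth_curve (\<lambda>\<theta>. \<gamma> (of_real r * cis \<theta>)))"

text \<open>The boundary values of an extension to \<open>I_dom \<epsilon>\<close> are taken continuously: \<open>\<Gamma>\<close> is
  continuous on the closed set \<open>I_dom \<epsilon> \<union> Fin ` circles \<epsilon>\<close>.\<close>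

definition loop_group_C :: "real \<Rightarrow> (complex^3^3) set \<Rightarrow> (complex \<Rightarrow> complex^3^3) set" where
  "loop_group_C \<epsilon> B =
     {\<gamma> \<in> circles \<epsilon> \<rightarrow>\<^sub>E SO3C.
        smooth_on_circles \<epsilon> \<gamma> \<and>
        (\<forall>z\<in>circles \<epsilon>. tau (\<gamma> z) = \<gamma> (- z)) \<and>
        (\<exists>\<Gamma>. (\<forall>z\<in>circles \<epsilon>. \<Gamma> (Fin z) = \<gamma> z) \<and>
             \<Gamma> ` I_dom \<epsilon> \<subseteq> SO3C \<and>
             cp1_continuous_on (I_dom \<epsilon> \<union> Fin ` circles \<epsilon>) \<Gamma> \<and>
             cp1_holomorphic_on (I_dom \<epsilon>) \<Gamma> \<and>
             \<Gamma> (Fin 0) \<in> B)}"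

definition loop_group_R :: "real \<Rightarrow> (complex^3^3) set \<Rightarrow> (complex \<Rightarrow> complex^3^3) set" where
  "loop_group_R \<epsilon> B =
     {\<gamma> \<in> loop_group_C \<epsilon> B. \<forall>z\<in>circles \<epsilon>. \<gamma> z = conj_mat (\<gamma> (1 / cnj z))}"

end

theory Submission
  imports Defs "HOL-Complex_Analysis.Cauchy_Integral_Formula"
begin

text \<open>An isotropic line with \<open>QL \<noteq> L\<close> is spanned by \<open>(1, \<i> cos x, \<i> sin x)\<close>; write
  \<open>p = exp (\<i> x)\<close>.  Rotating \<open>x\<close> to \<open>0\<close> turns a simple factor into a rotation in the first
  two coordinates, so \<open>p\<^bsub>\<alpha>,L\<^esub>\<close> is \<open>U(p) P(m) U(1/p)\<close> with complex rotations \<open>U\<close>, \<open>P\<close> about two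
  different axes and \<open>m = (\<alpha> - \<lambda>) / (\<alpha> + \<lambda>)\<close>.  Conjugation sends \<open>p\<close> to \<open>t p\<close>, where
  \<open>t = - 1 / |p|\<^sup>2\<close>, and the line \<open>L\<^sub>2'\<close> has parameter \<open>w p\<close>, where
  \<open>w = (\<alpha>\<^sub>1 t - \<alpha>\<^sub>2) / (\<alpha>\<^sub>1 - \<alpha>\<^sub>2 t)\<close>.  Since \<open>w\<close> is real, \<open>U(1/w)\<close> times the product of the two factors
  satisfies the reality condition: this reduces to the exchange identity
  \<open>P(m\<^sub>2) U(1/w) P(m\<^sub>1) U(t) = U(t) P(m\<^sub>1) U(1/w) P(m\<^sub>2)\<close>.  A real rotation on the left does not disturb
  reality, so the Iwasawa decomposition moves \<open>U(1/w)\<close> into \<open>B\<close>.\<close>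

section \<open>Complex rotations parametrised by nonzero complex numbers\<close>

text \<open>\<open>ucos p\<close> and \<open>usin p\<close> are \<open>cos x\<close> and \<open>sin x\<close> for \<open>p = exp (\<i> x)\<close>.\<close>

definition ucos :: "complex \<Rightarrow> complex" where
  "ucos p = (p + inverse p) / 2"

definition usin :: "complex \<Rightarrow> complex" where
  "usin p = \<i> * (inverse p - p) / 2"

definition U_rot :: "complex \<Rightarrow> complex^3^3" where
  "U_rot p = vector [vector [1, 0, 0], vector [0, ucos p, - usin p], vector [0, usin p, ucos p]]"

text \<open>The signs make \<open>iso_vec 1\<close> an eigenvector with eigenvalue \<open>m\<close>
  and \<open>iso_vec (- 1)\<close> one with eigenvalue \<open>inverse m\<close>, for nonzero
  \<open>m\<close>.\<close>

definition P_rot :: "complex \<Rightarrow> complex^3^3" where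
  "P_rot m = vector [vector [ucos m, usin m, 0], vector [- usin m, ucos m, 0], vector [0, 0, 1]]"

definition iso_vec :: "complex \<Rightarrow> complex^3" where
  "iso_vec p = vector [1, \<i> * ucos p, \<i> * usin p]"

text \<open>The image of the third basis vector under \<open>U_rot p\<close>; it spans the middle
  summand of the decomposition belonging to the line of \<open>iso_vec p\<close>.\<close>

definition axis_vec :: "complex \<Rightarrow> complex^3" where
  "axis_vec p = vector [0, - usin p, ucos p]"

definition line_of :: "complex^3 \<Rightarrow> (complex^3) set" where
  "line_of v = range (\<lambda>c. c *s v)"

lemmas matrix3_simps = vec_eq_iff forall_3 sum_3 matrix_matrix_mult_def matrix_vector_mult_def

lemma ucos_usin_sq: "p \<noteq> 0 \<Longrightarrow> (ucos p)\<^sup>2 + (usin p)\<^sup>2 = 1"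
  by (simp add: ucos_def usin_def field_simps power2_eq_square)

lemma ucos_mult: "p \<noteq> 0 \<Longrightarrow> q \<noteq> 0 \<Longrightarrow> ucos (p * q) = ucos p * ucos q - usin p * usin q"
  by (simp add: ucos_def usin_def field_simps)

lemma usin_mult: "p \<noteq> 0 \<Longrightarrow> q \<noteq> 0 \<Longrightarrow> usin (p * q) = usin p * ucos q + ucos p * usin q"
  by (simp add: ucos_def usin_def field_simps)

lemma ucos_inverse [simp]: "ucos (inverse p) = ucos p"
  by (simp add: ucos_def add.commute)

lemma usin_inverse [simp]: "usin (inverse p) = - usin p"
  by (simp add: usin_def right_diff_distrib diff_divide_distrib)

lemma ucos_minus [simp]: "ucos (- p) = - ucos p"
  by (simp add: ucos_def add_divide_distrib diff_divide_distrib)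

lemma usin_minus [simp]: "usin (- p) = - usin p"
  by (simp add: usin_def right_diff_distrib add_divide_distrib diff_divide_distrib)

lemma cnj_ucos: "cnj (ucos p) = ucos (inverse (cnj p))"
  by (simp add: ucos_def add.commute)

lemma cnj_usin: "cnj (usin p) = usin (inverse (cnj p))"
  by (simp add: usin_def algebra_simps)

lemma U_rot_mult: "p \<noteq> 0 \<Longrightarrow> q \<noteq> 0 \<Longrightarrow> U_rot p ** U_rot q = U_rot (p * q)"
  by (simp add: U_rot_def matrix3_simps ucos_mult usin_mult algebra_simps)

lemma U_rot_1: "U_rot 1 = mat 1"
  by (simp add: U_rot_def matrix3_simps ucos_def usin_def mat_def)

lemma U_rot_SO3C: "p \<noteq> 0 \<Longrightarrow> U_rot p \<in> SO3C"
  using ucos_usin_sq[of p]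
  by (simp add: SO3C_def orthogonal_matrix_def transpose_def U_rot_def matrix3_simps mat_def det_3
      power2_eq_square add.commute)

lemma P_rot_SO3C: "p \<noteq> 0 \<Longrightarrow> P_rot p \<in> SO3C"
  using ucos_usin_sq[of p]
  by (simp add: SO3C_def orthogonal_matrix_def transpose_def P_rot_def matrix3_simps mat_def det_3
      power2_eq_square add.commute)

lemma SO3C_mult: "A \<in> SO3C \<Longrightarrow> A' \<in> SO3C \<Longrightarrow> A ** A' \<in> SO3C"
proof -
  assume A: "A \<in> SO3C" and A': "A' \<in> SO3C"
  have "transpose (A ** A') ** (A ** A') = transpose A' ** (transpose A ** A) ** A'"
    "A ** A' ** transpose (A ** A') = A ** (A' ** transpose A') ** transpose A"
    by (simp_all only: matrix_transpose_mul matrix_mul_assoc)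
  with A A' show ?thesis by (simp add: SO3C_def orthogonal_matrix_def det_mul)
qed

lemma Q_mat_Q_mat: "Q_mat ** Q_mat = mat 1"
  by (simp add: Q_mat_def matrix3_simps mat_def)

lemma tau_mult: "tau (A ** A') = tau A ** tau A'"
proof -
  have "Q_mat ** A ** Q_mat ** (Q_mat ** A' ** Q_mat)
      = Q_mat ** A ** (Q_mat ** Q_mat) ** A' ** Q_mat"
    by (simp only: matrix_mul_assoc)
  then show ?thesis by (simp add: tau_def Q_mat_Q_mat matrix_mul_assoc)
qed

lemma tau_U_rot: "tau (U_rot p) = U_rot p"
  by (simp add: tau_def Q_mat_def U_rot_def matrix3_simps)

lemma tau_P_rot: "tau (P_rot m) = P_rot (inverse m)"
  by (simp add: tau_def Q_mat_def P_rot_def matrix3_simps)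

lemma conj_mat_mult: "conj_mat (A ** A') = conj_mat A ** conj_mat A'"
  by (simp add: conj_mat_def map_matrix_def matrix3_simps)

lemma conj_mat_U_rot: "conj_mat (U_rot p) = U_rot (inverse (cnj p))"
  by (simp add: conj_mat_def map_matrix_def U_rot_def matrix3_simps cnj_ucos cnj_usin)

lemma conj_mat_P_rot: "conj_mat (P_rot p) = P_rot (inverse (cnj p))"
  by (simp add: conj_mat_def map_matrix_def P_rot_def matrix3_simps cnj_ucos cnj_usin)

lemma U_rot_KC: "p \<noteq> 0 \<Longrightarrow> U_rot p \<in> KC_grp"
  by (simp add: KC_grp_def U_rot_SO3C) (simp add: U_rot_def matrix3_simps axis_def)

section \<open>Isotropic lines and their parameters\<close>

lemma U_rot_iso_vec: "p \<noteq> 0 \<Longrightarrow> q \<noteq> 0 \<Longrightarrow> U_rot p *v iso_vec q = iso_vec (p * q)"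
  by (simp add: U_rot_def iso_vec_def matrix3_simps ucos_mult usin_mult algebra_simps)

lemma Q_iso_vec: "Q_mat *v iso_vec p = iso_vec (- p)"
  by (simp add: Q_mat_def iso_vec_def matrix3_simps)

lemma conj_iso_vec: "conj_vec (iso_vec p) = iso_vec (- inverse (cnj p))"
  by (simp add: conj_vec_def iso_vec_def matrix3_simps cnj_ucos cnj_usin)

lemma mat_image_line_of: "mat_image A (line_of v) = line_of (A *v v)"
  by (auto simp: line_of_def image_image vector_scalar_commute[symmetric])

lemma conj_line_of: "conj_vec ` line_of v = line_of (conj_vec v)"
proof -
  have "conj_vec (c *s v) = cnj c *s conj_vec v" for c
    by (simp add: conj_vec_def matrix3_simps)
  then have "conj_vec ` line_of v = (\<lambda>c. c *s conj_vec v) ` range cnj"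
    by (auto simp: line_of_def image_image)
  moreover have "range cnj = UNIV" by (metis complex_cnj_cnj surjI)
  ultimately show ?thesis by (simp add: line_of_def)
qed

lemma line_of_scale: "c \<noteq> 0 \<Longrightarrow> line_of (c *s v) = line_of v"
  unfolding line_of_def
  by (auto simp: image_iff) (metis nonzero_divide_eq_eq)

text \<open>A spanning vector with first coordinate 0 would be negated by \<open>Q_mat\<close>, so
  that the line would be fixed. Hence the first coordinate can be scaled to 1, and isotropy becomes
  the equation of a conic with a rational parametrisation.\<close>

lemma isotropic_line_eq:
  assumes L: "isotropic_line L" and Q: "mat_image Q_mat L \<noteq> L"
  shows "\<exists>p. p \<noteq> 0 \<and> L = line_of (iso_vec p)"
proof -
  have sub: "vec.subspace L" and d: "vec.dim L = 1" and iso: "isotropic L"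
    using L by (auto simp: isotropic_line_def)
  obtain b where b: "b \<subseteq> L" "vec.independent b" "L \<subseteq> vec.span b" "card b = 1"
    using vec.basis_exists[of L] d by metis
  then obtain v where v: "b = {v}" using card_1_singletonE by metis
  have Lv: "L = line_of v"
    using b v vec.span_minimal[OF b(1) sub] by (auto simp: line_of_def vec.span_singleton)
  have vL: "v \<in> L" using b v by simp
  then have "cbil v v = 0" using iso by (simp add: isotropic_def)
  then have sq: "(v$1)\<^sup>2 + (v$2)\<^sup>2 + (v$3)\<^sup>2 = 0"
    by (simp add: cbil_def sum_3 power2_eq_square)
  have v1: "v $ 1 \<noteq> 0"
  proof
    assume "v $ 1 = 0"
    then have "Q_mat *v v = (-1) *s v" by (simp add: Q_mat_def matrix3_simps)
    then have "mat_image Q_mat L = L" using Lv mat_image_line_of line_of_scale[of "-1" v] by simp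
    then show False using Q by simp
  qed
  define x y where "x = v$2 / v$1" and "y = v$3 / v$1"
  have xy: "x\<^sup>2 + y\<^sup>2 = -1"
    using sq v1 by (simp add: x_def y_def field_simps eq_neg_iff_add_eq_0)
  \<comment> \<open>The conic \<open>x^2 + y^2 = -1\<close> factors as (y - i x)(- y - i x) = 1, so
    the two factors are \<open>p\<close> and its inverse.\<close>
  define p where "p = y - \<i> * x"
  have pq: "p * (- y - \<i> * x) = 1" using xy by (simp add: p_def algebra_simps power2_eq_square) algebra
  then have p0: "p \<noteq> 0" by auto
  then have ip: "inverse p = - y - \<i> * x" using pq by (metis inverse_unique)
  have "v = v$1 *s iso_vec p"
    using v1 by (simp add: matrix3_simps iso_vec_def ucos_def usin_def ip)
      (simp add: p_def algebra_simps x_def y_def)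
  then have "L = line_of (iso_vec p)" using Lv line_of_scale[OF v1] by metis
  with p0 show ?thesis by blast
qed

section \<open>Frames adapted to an isotropic line\<close>

text \<open>\<open>U_rot p\<close> carries the eigenvectors of \<open>P_rot m\<close> to
  \<open>iso_vec p\<close>, \<open>axis_vec p\<close> and \<open>iso_vec (- p)\<close>. For nonzero
  \<open>p\<close> and \<open>m\<close> the conjugate therefore has eigenvalues \<open>m\<close>, 1
  and \<open>inverse m\<close> on them, as a simple factor must.\<close>

definition frame_factor :: "complex \<Rightarrow> complex \<Rightarrow> complex^3^3" where
  "frame_factor p m = U_rot p ** P_rot m ** U_rot (inverse p)"

lemma proj_along_eq:
  assumes "\<And>v. f v \<in> S" "\<And>v. v - f v \<in> W"
    and "\<And>v u. u \<in> S \<Longrightarrow> v - u \<in> W \<Longrightarrow> u = f v"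
  shows "proj_along S W = matrix f"
proof -
  have "(THE u. u \<in> S \<and> v - u \<in> W) = f v" for v
    using assms by (intro the_equality) blast+
  then show ?thesis by (simp add: proj_along_def)
qed

lemma cbil_linear:
  "cbil u (v + w) = cbil u v + cbil u w" "cbil u (v - w) = cbil u v - cbil u w"
  "cbil u (c *s v) = c * cbil u v"
  by (simp_all add: cbil_def sum_3 algebra_simps)

lemma cbil_commute: "cbil u v = cbil v u"
  by (simp add: cbil_def mult.commute)

lemma frame_products:
  assumes "p \<noteq> 0"
  shows "cbil (iso_vec p) (iso_vec p) = 0" "cbil (iso_vec (-p)) (iso_vec (-p)) = 0"
    "cbil (iso_vec p) (iso_vec (-p)) = 2" "cbil (iso_vec (-p)) (iso_vec p) = 2"
    "cbil (iso_vec p) (axis_vec p) = 0" "cbil (axis_vec p) (iso_vec p) = 0"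
    "cbil (iso_vec (-p)) (axis_vec p) = 0" "cbil (axis_vec p) (iso_vec (-p)) = 0"
    "cbil (axis_vec p) (axis_vec p) = 1"
  using ucos_usin_sq[OF assms]
  by (simp_all add: cbil_def sum_3 iso_vec_def axis_vec_def power2_eq_square algebra_simps)

text \<open>The two isotropic vectors pair to 2 with each other and to 0 with themselves, so the
  coefficient of one is half the product with the other; \<open>axis_vec p\<close> is a unit vector
  orthogonal to both.\<close>

lemma frame_expansion:
  assumes "p \<noteq> 0"
  shows "v = (cbil (iso_vec (-p)) v / 2) *s iso_vec p + cbil (axis_vec p) v *s axis_vec p
           + (cbil (iso_vec p) v / 2) *s iso_vec (-p)"
proof -
  note sq = ucos_usin_sq[OF assms]
  define c s where "c = ucos p" and "s = usin p"
  have cs: "c * c + s * s = 1" using sq by (simp add: c_def s_def power2_eq_square)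
  \<comment> \<open>The second and third coordinates of the expansion; they hold only modulo c^2 +
    s^2 = 1, unlike the first.\<close>
  have e2: "x = (a - \<i> * c * x - \<i> * s * y) * (\<i> * c) / 2 + (s * x * s - c * y * s)
      - (a + \<i> * c * x + \<i> * s * y) * (\<i> * c) / 2"
    "y = (a - \<i> * c * x - \<i> * s * y) * (\<i> * s) / 2 + (c * y * c - s * x * c)
      - (a + \<i> * c * x + \<i> * s * y) * (\<i> * s) / 2" for a x y
  proof -
    have "x = (c * c + s * s) * x" "y = (c * c + s * s) * y" by (simp_all add: cs)
    then show "x = (a - \<i> * c * x - \<i> * s * y) * (\<i> * c) / 2 + (s * x * s - c * y * s)
      - (a + \<i> * c * x + \<i> * s * y) * (\<i> * c) / 2"
    "y = (a - \<i> * c * x - \<i> * s * y) * (\<i> * s) / 2 + (c * y * c - s * x * c)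
      - (a + \<i> * c * x + \<i> * s * y) * (\<i> * s) / 2"
      by (simp_all add: field_simps) (use cs in algebra)+
  qed
  show ?thesis
    unfolding matrix3_simps cbil_def
    by (simp add: iso_vec_def axis_vec_def c_def[symmetric] s_def[symmetric] e2[symmetric])
      (simp add: field_simps)
qed

section \<open>The exchange identity for rotations about two axes\<close>

text \<open>The scalars \<open>k1, \<dots>, k4\<close> stand for the inverted denominators of the matrix entries: with
  them the exchange identity is polynomial.\<close>

lemma rotation_exchange_scaled:
  fixes a b t u v z k1 k2 k3 k4 :: complex
  defines "N1 \<equiv> vector [vector [k1 * (a\<^sup>2 + z\<^sup>2), k1 * (2 * \<i> * a * z), 0],
       vector [- k1 * (2 * \<i> * a * z), k1 * (a\<^sup>2 + z\<^sup>2), 0], vector [0, 0, k1 * (a\<^sup>2 - z\<^sup>2)]] :: complex^3^3"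
  defines "N2 \<equiv> vector [vector [k2 * (b\<^sup>2 + z\<^sup>2), k2 * (2 * \<i> * b * z), 0],
       vector [- k2 * (2 * \<i> * b * z), k2 * (b\<^sup>2 + z\<^sup>2), 0], vector [0, 0, k2 * (b\<^sup>2 - z\<^sup>2)]] :: complex^3^3"
  defines "N3 \<equiv> vector [vector [k3 * (2 * u * v), 0, 0],
       vector [0, k3 * (u\<^sup>2 + v\<^sup>2), - k3 * (\<i> * (v\<^sup>2 - u\<^sup>2))],
       vector [0, k3 * (\<i> * (v\<^sup>2 - u\<^sup>2)), k3 * (u\<^sup>2 + v\<^sup>2)]] :: complex^3^3"
  defines "N4 \<equiv> vector [vector [k4 * (2 * t), 0, 0],
       vector [0, k4 * (t\<^sup>2 + 1), - k4 * (\<i> * (1 - t\<^sup>2))],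
       vector [0, k4 * (\<i> * (1 - t\<^sup>2)), k4 * (t\<^sup>2 + 1)]] :: complex^3^3"
  assumes "u = a - b * t" "v = a * t - b"
  shows "N2 ** N3 ** N1 ** N4 = N4 ** N1 ** N3 ** N2"
  unfolding N1_def N2_def N3_def N4_def assms(5,6) matrix3_simps
  by (simp add: power2_eq_square) (simp add: algebra_simps)

lemma moebius_denominators_nonzero:
  fixes a z :: complex
  assumes "z \<noteq> a" "z \<noteq> - a"
  shows "a + z \<noteq> 0" "a - z \<noteq> 0" "a\<^sup>2 - z\<^sup>2 \<noteq> 0"
  using assms by (auto simp: add_eq_0_iff power2_eq_iff)

text \<open>The inverted denominator is kept as a separate scalar in order to match the scaled
  matrices of \<open>rotation_exchange_scaled\<close>.\<close>

lemma ucos_quotient: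
  assumes "x \<noteq> 0" "y \<noteq> 0"
  shows "ucos (x / y) = inverse (2 * x * y) * (x\<^sup>2 + y\<^sup>2)"
    "usin (x / y) = inverse (2 * x * y) * (\<i> * (y\<^sup>2 - x\<^sup>2))"
  using assms by (simp_all add: ucos_def usin_def field_simps power2_eq_square)

lemma ucos_usin_moebius:
  fixes a z :: complex
  assumes "z \<noteq> a" "z \<noteq> - a"
  shows "ucos ((a - z) / (a + z)) = inverse (a\<^sup>2 - z\<^sup>2) * (a\<^sup>2 + z\<^sup>2)"
    "usin ((a - z) / (a + z)) = inverse (a\<^sup>2 - z\<^sup>2) * (2 * \<i> * a * z)"
proof -
  note nz = moebius_denominators_nonzero[OF assms]
  have "2 * (a - z) * (a + z) = 2 * (a\<^sup>2 - z\<^sup>2)" by (simp add: power2_eq_square algebra_simps)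
  then have e: "inverse (2 * (a - z) * (a + z)) * (2 * x) = inverse (a\<^sup>2 - z\<^sup>2) * x" for x
    by (simp only: inverse_mult_distrib) simp
  have e2: "(a - z)\<^sup>2 + (a + z)\<^sup>2 = 2 * (a\<^sup>2 + z\<^sup>2)" "(a + z)\<^sup>2 - (a - z)\<^sup>2 = 2 * (2 * a * z)"
    by (simp_all add: power2_eq_square algebra_simps)
  show "ucos ((a - z) / (a + z)) = inverse (a\<^sup>2 - z\<^sup>2) * (a\<^sup>2 + z\<^sup>2)"
    "usin ((a - z) / (a + z)) = inverse (a\<^sup>2 - z\<^sup>2) * (2 * \<i> * a * z)"
    using e[of "a\<^sup>2 + z\<^sup>2"] e[of "\<i> * (2 * a * z)"] unfolding ucos_quotient[OF nz(2,1)] e2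
    by (simp_all add: algebra_simps)
qed

text \<open>Dividing the polynomial identity by the denominators gives the claim. The
  \<open>w\<close> used here is the inverse of the parameter \<open>w\<close> in
  \<open>twisted_product_real\<close>, where the middle rotation is
  \<open>U_rot (inverse w)\<close>.\<close>

lemma rotation_exchange:
  fixes a b t z :: complex
  assumes "z \<noteq> a" "z \<noteq> -a" "z \<noteq> b" "z \<noteq> -b" "t \<noteq> 0" "a * t \<noteq> b" "a \<noteq> b * t"
  defines "w \<equiv> (a - b * t) / (a * t - b)"
    and "m \<equiv> (a - z) / (a + z)" and "n \<equiv> (b - z) / (b + z)"
  shows "P_rot n ** U_rot w ** P_rot m ** U_rot t = U_rot t ** P_rot m ** U_rot w ** P_rot n"
proof -
  define u v where "u = a - b * t" and "v = a * t - b"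
  have uv: "u \<noteq> 0" "v \<noteq> 0" using assms by (auto simp: u_def v_def)
  note nz = moebius_denominators_nonzero[OF assms(1,2)] moebius_denominators_nonzero[OF assms(3,4)]
  have w: "w = u / v" by (simp add: w_def u_def v_def)
  have t: "ucos t = inverse (2 * t) * (t\<^sup>2 + 1)" "usin t = inverse (2 * t) * (\<i> * (1 - t\<^sup>2))"
    using ucos_quotient[of t 1] assms(5) by simp_all
  note e = ucos_usin_moebius[OF assms(1,2), folded m_def] ucos_usin_moebius[OF assms(3,4), folded n_def]
    ucos_quotient[OF uv, folded w] t
  \<comment> \<open>The constant diagonal entries of the rotations also carry a scalar in the scaled
    identity; these equations turn them back into 1.\<close>
  have one: "1 = inverse (a\<^sup>2 - z\<^sup>2) * (a\<^sup>2 - z\<^sup>2)" "1 = inverse (b\<^sup>2 - z\<^sup>2) * (b\<^sup>2 - z\<^sup>2)"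
     "1 = inverse (2 * u * v) * (2 * u * v)" "1 = inverse (2 * t) * (2 * t)"
    using nz uv assms(5) by (simp_all del: inverse_mult_distrib)
  note y = rotation_exchange_scaled[OF u_def v_def, of "inverse (b\<^sup>2 - z\<^sup>2)" z "inverse (2 * u * v)" "inverse (a\<^sup>2 - z\<^sup>2)" "inverse (2 * t)"]
  show ?thesis
    using y unfolding one[symmetric] mult_minus_left e[symmetric]
    by (simp only: P_rot_def U_rot_def)
qed

section \<open>Simple factors as conjugated plane rotations\<close>

text \<open>Orthogonality to both isotropic vectors removes two of the three terms in
  \<open>frame_expansion\<close>, leaving a multiple of \<open>axis_vec p\<close>.\<close>

lemma bil_perp_frame:
  assumes "p \<noteq> 0"
  shows "bil_perp (subspace_sum (line_of (iso_vec p)) (line_of (iso_vec (- p)))) = line_of (axis_vec p)"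
proof
  show "line_of (axis_vec p) \<subseteq> bil_perp (subspace_sum (line_of (iso_vec p)) (line_of (iso_vec (- p))))"
    by (auto simp: bil_perp_def subspace_sum_def line_of_def cbil_linear cbil_commute[of "c *s v" for c v]
        frame_products[OF assms])
  show "bil_perp (subspace_sum (line_of (iso_vec p)) (line_of (iso_vec (- p)))) \<subseteq> line_of (axis_vec p)"
  proof
    fix v assume v: "v \<in> bil_perp (subspace_sum (line_of (iso_vec p)) (line_of (iso_vec (- p))))"
    have "iso_vec p = 1 *s iso_vec p + 0 *s iso_vec (- p)" "iso_vec (- p) = 0 *s iso_vec p + 1 *s iso_vec (- p)"
      by simp_all
    then have "iso_vec p \<in> subspace_sum (line_of (iso_vec p)) (line_of (iso_vec (- p)))"
      "iso_vec (- p) \<in> subspace_sum (line_of (iso_vec p)) (line_of (iso_vec (- p)))"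
      unfolding subspace_sum_def line_of_def by blast+
    with v have "cbil (iso_vec p) v = 0" "cbil (iso_vec (-p)) v = 0"
      by (auto simp: bil_perp_def cbil_commute[of v])
    then have "v = cbil (axis_vec p) v *s axis_vec p"
      using frame_expansion[OF assms, of v] by simp
    then show "v \<in> line_of (axis_vec p)" unfolding line_of_def by blast
  qed
qed

text \<open>Stated for arbitrary coordinate functions, so that all three projections of a simple
  factor arise by permuting the frame.\<close>

lemma proj_along_frame:
  assumes v: "\<And>v. v = f v *s a + g v *s b + h v *s c"
    and f: "\<And>x y z. f (x *s a + y *s b + z *s c) = x"
  shows "proj_along (line_of a) (subspace_sum (line_of b) (line_of c)) = matrix (\<lambda>v. f v *s a)"
proof (rule proj_along_eq)
  fix v u
  show "f v *s a \<in> line_of a" unfolding line_of_def by blast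
  have "v - f v *s a = g v *s b + h v *s c" using v[of v] by (metis add.assoc add_diff_cancel_left')
  then show "v - f v *s a \<in> subspace_sum (line_of b) (line_of c)"
    unfolding subspace_sum_def line_of_def by blast
  assume "u \<in> line_of a" "v - u \<in> subspace_sum (line_of b) (line_of c)"
  then obtain x y z where u: "u = x *s a" "v - u = y *s b + z *s c"
    unfolding subspace_sum_def line_of_def by blast
  then have "v = x *s a + y *s b + z *s c" by (simp add: algebra_simps)
  then show "u = f v *s a" using f u by simp
qed

lemma proj_frame:
  assumes "p \<noteq> 0"
  defines "a \<equiv> iso_vec p" and "b \<equiv> axis_vec p" and "c \<equiv> iso_vec (- p)"
  shows "proj_along (line_of a) (subspace_sum (line_of b) (line_of c)) = matrix (\<lambda>v. (cbil c v / 2) *s a)"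
    "proj_along (line_of b) (subspace_sum (line_of a) (line_of c)) = matrix (\<lambda>v. cbil b v *s b)"
    "proj_along (line_of c) (subspace_sum (line_of a) (line_of b)) = matrix (\<lambda>v. (cbil a v / 2) *s c)"
proof -
  note fe = frame_expansion[OF assms(1), folded a_def b_def c_def]
  note fp = frame_products[OF assms(1), folded a_def b_def c_def]
  show "proj_along (line_of a) (subspace_sum (line_of b) (line_of c)) = matrix (\<lambda>v. (cbil c v / 2) *s a)"
    by (rule proj_along_frame[OF fe]) (simp add: cbil_linear fp)
  show "proj_along (line_of b) (subspace_sum (line_of a) (line_of c)) = matrix (\<lambda>v. cbil b v *s b)"
    by (rule proj_along_frame[OF fe[unfolded add.commute[of "_ *s a" "_ *s b"]]]) (simp add: cbil_linear fp)
  have "v = (cbil a v / 2) *s c + (cbil c v / 2) *s a + cbil b v *s b" for v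
    using fe[of v] by (metis add.assoc add.commute)
  then show "proj_along (line_of c) (subspace_sum (line_of a) (line_of b)) = matrix (\<lambda>v. (cbil a v / 2) *s c)"
    by (rule proj_along_frame) (simp add: cbil_linear fp)
qed

lemma simple_factor_eq:
  assumes p: "p \<noteq> 0"
  shows "simple_factor \<alpha> (line_of (iso_vec p)) z = frame_factor p (moebius \<alpha> z)"
proof -
  let ?m = "moebius \<alpha> z"
  \<comment> \<open>With \<open>C = ucos m\<close> and \<open>S = usin m\<close> one has m = C + i S
    and \<open>inverse m\<close> = C - i S. Both sides become linear in \<open>C\<close> and
    \<open>S\<close> and can be compared entry by entry.\<close>
  have key: "map_matrix ((*) x) (matrix (\<lambda>v. (cbil (iso_vec (- p)) v / 2) *s iso_vec p))
     + matrix (\<lambda>v. cbil (axis_vec p) v *s axis_vec p)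
     + map_matrix ((*) y) (matrix (\<lambda>v. (cbil (iso_vec p) v / 2) *s iso_vec (- p)))
     = U_rot p ** vector [vector [C, S, 0], vector [- S, C, 0], vector [0, 0, 1]] ** U_rot (inverse p)"
    if "x = C + \<i> * S" "y = C - \<i> * S" for x y C S
    unfolding that
    by (simp add: map_matrix_def matrix_def matrix3_simps U_rot_def cbil_def axis_def
       iso_vec_def axis_vec_def)
      (simp add: field_simps)
  have "simple_factor \<alpha> (line_of (iso_vec p)) z =
     map_matrix ((*) ?m) (matrix (\<lambda>v. (cbil (iso_vec (- p)) v / 2) *s iso_vec p))
     + matrix (\<lambda>v. cbil (axis_vec p) v *s axis_vec p)
     + map_matrix ((*) (inverse ?m)) (matrix (\<lambda>v. (cbil (iso_vec p) v / 2) *s iso_vec (- p)))"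
    by (simp add: simple_factor_def Let_def mat_image_line_of Q_iso_vec bil_perp_frame[OF p] proj_frame[OF p])
  also have "\<dots> = frame_factor p ?m"
    unfolding frame_factor_def P_rot_def by (rule key) (simp_all add: ucos_def usin_def field_simps)
  finally show ?thesis .
qed

lemma frame_factor_SO3C: "p \<noteq> 0 \<Longrightarrow> m \<noteq> 0 \<Longrightarrow> frame_factor p m \<in> SO3C"
  by (simp add: frame_factor_def SO3C_mult U_rot_SO3C P_rot_SO3C)

lemma tau_frame_factor: "tau (frame_factor p m) = frame_factor p (inverse m)"
  by (simp add: frame_factor_def tau_mult tau_U_rot tau_P_rot)

section \<open>Smoothness along circles\<close>

lemma has_vector_derivative_vecI:
  fixes f :: "real \<Rightarrow> 'a::real_normed_vector ^ 'n"
  assumes "\<And>i. ((\<lambda>t. f t $ i) has_vector_derivative f' $ i) (at t)"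
  shows "(f has_vector_derivative f') (at t)"
  using assms unfolding has_vector_derivative_def has_derivative_def
  by (auto intro!: vec_tendstoI bounded_linear_scaleR_left)

text \<open>The circle is the image of the real axis under the entire map z -> r exp(i z). Pulled
  back, the entries are holomorphic near the real axis, and their higher complex derivatives
  restrict to the real derivatives.\<close>

lemma smooth_curve_circle:
  fixes f :: "complex \<Rightarrow> complex^3^3"
  assumes f: "\<And>i j. (\<lambda>z. f z $ i $ j) holomorphic_on S" and S: "open S"
    and r: "\<And>\<theta>. of_real r * cis \<theta> \<in> S"
  shows "smooth_curve (\<lambda>\<theta>. f (of_real r * cis \<theta>))"
proof -
  define e where "e = (\<lambda>z. of_real r * exp (\<i> * z))"
  define V where "V = e -` S"
  have "continuous_on UNIV e" unfolding e_def by (intro continuous_intros)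
  then have V: "open V" unfolding V_def using S by (simp add: open_vimage)
  define g where "g = (\<lambda>i j z. f (e z) $ i $ j)"
  have "e holomorphic_on V" unfolding e_def by (intro holomorphic_intros)
  then have g: "g i j holomorphic_on V" for i j
    using holomorphic_on_compose_gen[OF _ f, of e V i j] by (auto simp: V_def g_def o_def)
  have re: "of_real \<theta> \<in> V" "e (of_real \<theta>) = of_real r * cis \<theta>" for \<theta>
    using r by (simp_all add: V_def e_def cis_conv_exp)
  define D where "D = (\<lambda>n \<theta>. (\<chi> i j. (deriv ^^ n) (g i j) (of_real \<theta>)))"
  have "D 0 = (\<lambda>\<theta>. f (of_real r * cis \<theta>))"
    by (simp add: D_def g_def re vec_eq_iff fun_eq_iff)
  moreover have "(D n has_vector_derivative D (Suc n) t) (at t)" for n t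
  proof -
    have "((\<lambda>\<theta>. (deriv ^^ n) (g i j) (of_real \<theta>)) has_vector_derivative (deriv ^^ Suc n) (g i j) (of_real t)) (at t)" for i j
    proof -
      have "(deriv ^^ n) (g i j) holomorphic_on V" using g V by (rule holomorphic_higher_deriv)
      then have "((deriv ^^ n) (g i j) has_field_derivative (deriv ^^ Suc n) (g i j) (of_real t)) (at (of_real t))"
        using holomorphic_derivI[OF _ V re(1)] by simp
      then show ?thesis by (rule has_vector_derivative_real_field)
    qed
    then show ?thesis
      unfolding D_def by (intro has_vector_derivative_vecI) simp
  qed
  ultimately show ?thesis unfolding smooth_curve_def by blast
qed

section \<open>The image of an isotropic line under a simple factor\<close>

text \<open>This yields the parameter of \<open>L\<^sub>2'\<close>. Conjugating by
  \<open>U_rot p\<close> reduces the claim to \<open>P_rot\<close> acting on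
  \<open>iso_vec t\<close>.\<close>

lemma frame_factor_iso_vec:
  assumes "p \<noteq> 0" "t \<noteq> 0" "a \<noteq> b" "a \<noteq> - b" "a * t \<noteq> b" "a \<noteq> b * t"
  shows "\<exists>c. c \<noteq> 0 \<and> frame_factor p ((a - b) / (a + b)) *v iso_vec (t * p) = c *s iso_vec (((a * t - b) / (a - b * t)) * p)"
proof -
  define u v where "u = a * t - b" and "v = a - b * t"
  define w where "w = u / v"
  \<comment> \<open>The first coordinate of \<open>iso_vec\<close> is 1, so \<open>c\<close> has to
    be the first coordinate of the image of \<open>iso_vec t\<close>.\<close>
  define c where "c = u * v / (t * (a\<^sup>2 - b\<^sup>2))"
  let ?m = "(a - b) / (a + b)"
  have ba: "b \<noteq> a" "b \<noteq> - a" using assms by auto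
  have nz: "u \<noteq> 0" "v \<noteq> 0" "a\<^sup>2 - b\<^sup>2 \<noteq> 0"
    using assms moebius_denominators_nonzero(3)[OF ba] by (auto simp: u_def v_def)
  then have w: "w \<noteq> 0" and c: "c \<noteq> 0" using assms by (simp_all add: w_def c_def)
  define k where "k = inverse (2 * t * (a\<^sup>2 - b\<^sup>2))"
  have m: "ucos ?m = k * (2 * t * (a\<^sup>2 + b\<^sup>2))" "usin ?m = k * (4 * \<i> * t * a * b)"
    using nz assms(2) unfolding ucos_usin_moebius[OF ba] k_def by (simp_all add: field_simps)
  have cw: "c = k * (2 * u * v)" "c * ucos w = k * (u\<^sup>2 + v\<^sup>2)" "c * usin w = k * (\<i> * (v\<^sup>2 - u\<^sup>2))"
    using nz assms(2) unfolding c_def k_def ucos_quotient[OF nz(1,2), folded w_def]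
    by (simp_all add: field_simps)
  have tt: "ucos t = (t\<^sup>2 + 1) / (2 * t)" "usin t = k * (\<i> * (1 - t\<^sup>2) * (a\<^sup>2 - b\<^sup>2))"
    using nz assms(2) unfolding k_def ucos_def usin_def by (simp_all add: field_simps power2_eq_square)
  have "ucos ?m * ucos t = k * ((a\<^sup>2 + b\<^sup>2) * (t\<^sup>2 + 1))" "usin ?m * ucos t = k * (2 * \<i> * a * b * (t\<^sup>2 + 1))"
    unfolding m tt using assms(2) by (simp_all add: field_simps)
  note pr = this
  have "ucos ?m + \<i> * (usin ?m * ucos t) = c" "\<i> * (ucos ?m * ucos t) - usin ?m = \<i> * (c * ucos w)"
    unfolding pr cw(2) unfolding m cw(1) by (simp_all add: u_def v_def power2_eq_square algebra_simps)
  moreover have "usin t = c * usin w"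
    unfolding tt cw(3) by (simp add: u_def v_def power2_eq_square algebra_simps)
  ultimately have "P_rot ?m *v iso_vec t = c *s iso_vec w"
    by (simp add: matrix3_simps P_rot_def iso_vec_def algebra_simps)
  moreover have "inverse p * (t * p) = t" using assms(1) by simp
  then have "U_rot (inverse p) *v iso_vec (t * p) = iso_vec t"
    using U_rot_iso_vec[of "inverse p" "t * p"] assms(1,2) by (simp only: inverse_nonzero_iff_nonzero mult_eq_0_iff simp_thms)
  ultimately have "frame_factor p ?m *v iso_vec (t * p) = c *s iso_vec (w * p)"
    using assms(1,2) w
    by (simp add: frame_factor_def matrix_vector_mul_assoc[symmetric] U_rot_iso_vec vector_scalar_commute mult.commute[of w])
  with c show ?thesis unfolding w_def u_def v_def by blast
qed


section \<open>Holomorphy in the two charts of the projective line\<close>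

lemma holomorphic_matrix_mult:
  fixes A C :: "complex \<Rightarrow> complex^3^3"
  assumes "\<And>i j. (\<lambda>z. A z $ i $ j) holomorphic_on S" "\<And>i j. (\<lambda>z. C z $ i $ j) holomorphic_on S"
  shows "(\<lambda>z. (A z ** C z) $ i $ j) holomorphic_on S"
  unfolding matrix_matrix_mult_def sum_3 using assms by (simp add: holomorphic_on_add holomorphic_on_mult)

lemma holomorphic_frame_factor:
  assumes m: "m holomorphic_on S" "\<And>z. z \<in> S \<Longrightarrow> m z \<noteq> 0"
  shows "(\<lambda>z. frame_factor p (m z) $ i $ j) holomorphic_on S"
proof -
  have "(\<lambda>z. ucos (m z)) holomorphic_on S" "(\<lambda>z. usin (m z)) holomorphic_on S"
    using m unfolding ucos_def usin_def by (auto intro!: holomorphic_intros)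
  then have "(\<lambda>z. P_rot (m z) $ i $ j) holomorphic_on S" for i j
    using exhaust_3[of i] exhaust_3[of j] by (auto simp: P_rot_def intro!: holomorphic_intros)
  then show ?thesis
    unfolding frame_factor_def by (intro holomorphic_matrix_mult) auto
qed

lemma moebius_nonzero: "x \<noteq> Fin a \<Longrightarrow> x \<noteq> Fin (- a) \<Longrightarrow> Defs.moebius a x \<noteq> 0"
  by (cases x) (auto simp: add_eq_0_iff)

text \<open>In the coordinate w = 1 / z the factor is again a quotient of linear functions, with
  value -1 at w = 0, so infinity is a regular point.\<close>

lemma moebius_chart_inf: "Defs.moebius a (chart_inf w) = (a * w - 1) / (a * w + 1)"
proof (cases "w = 0")
  case False
  then have "a - 1 / w = (a * w - 1) / w" "a + 1 / w = (a * w + 1) / w" by (simp_all add: field_simps)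
  with False show ?thesis by (simp add: chart_inf_def)
qed (simp add: chart_inf_def)

lemma chart_inf_pole:
  assumes "chart_inf w \<noteq> Fin c"
  shows "c * w \<noteq> 1"
  using assms by (cases "w = 0") (auto simp: chart_inf_def field_simps)

text \<open>The entries contain both the Moebius value and its inverse, so its zeros
  \<open>a\<close>, \<open>b\<close> are removed along with its poles \<open>- a\<close>,
  \<open>- b\<close>.\<close>

lemma frame_factor_product_holomorphic:
  fixes M :: "complex^3^3" and a b p q :: complex
  assumes R: "R \<inter> {Fin a, Fin (- a), Fin b, Fin (- b)} = {}"
  defines "G \<equiv> \<lambda>x. M ** frame_factor q (Defs.moebius b x) ** frame_factor p (Defs.moebius a x)"
  shows "(\<lambda>z. G (Fin z) $ i $ j) holomorphic_on (Fin -` R)"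
    "(\<lambda>w. G (chart_inf w) $ i $ j) holomorphic_on (chart_inf -` R)"
proof -
  have 1: "(\<lambda>z. Defs.moebius c (Fin z)) holomorphic_on (Fin -` R)"
    "(\<lambda>w. Defs.moebius c (chart_inf w)) holomorphic_on (chart_inf -` R)" if "c = a \<or> c = b" for c
  proof -
    have "c + z \<noteq> 0" if "Fin z \<in> R" for z
      using R that \<open>c = a \<or> c = b\<close> by (auto simp: add_eq_0_iff)
    then show "(\<lambda>z. Defs.moebius c (Fin z)) holomorphic_on (Fin -` R)"
      by (auto intro!: holomorphic_intros)
    have "c * w + 1 \<noteq> 0" if "chart_inf w \<in> R" for w
    proof -
      have "chart_inf w \<noteq> Fin (- c)" using R that \<open>c = a \<or> c = b\<close> by auto
      then have "- (c * w) \<noteq> 1" using chart_inf_pole[of w "- c"] by simp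
      then show ?thesis by (auto simp: add_eq_0_iff)
    qed
    then show "(\<lambda>w. Defs.moebius c (chart_inf w)) holomorphic_on (chart_inf -` R)"
      unfolding moebius_chart_inf by (auto intro!: holomorphic_intros)
  qed
  have 2: "Defs.moebius c x \<noteq> 0" if "c = a \<or> c = b" "x \<in> R" for c x
    using R that moebius_nonzero[of x c] by auto
  show "(\<lambda>z. G (Fin z) $ i $ j) holomorphic_on (Fin -` R)"
    unfolding G_def by (intro holomorphic_matrix_mult holomorphic_frame_factor 1) (use 2 in \<open>auto simp del: moebius.simps\<close>)
  show "(\<lambda>w. G (chart_inf w) $ i $ j) holomorphic_on (chart_inf -` R)"
    unfolding G_def by (intro holomorphic_matrix_mult holomorphic_frame_factor 1) (use 2 in \<open>auto simp del: moebius.simps\<close>)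
qed

lemma continuous_on_holomorphic_entries:
  fixes f :: "complex \<Rightarrow> complex^3^3"
  assumes "\<And>i j. (\<lambda>z. f z $ i $ j) holomorphic_on S"
  shows "continuous_on S f"
proof -
  have "continuous_on S (\<lambda>z. \<chi> i j. f z $ i $ j)"
    using assms by (intro continuous_on_vec_lambda holomorphic_on_imp_continuous_on)
  then show ?thesis by simp
qed

section \<open>The reality condition\<close>

text \<open>Since z -> 1 / cnj z exchanges \<open>a\<close> and \<open>b\<close>, conjugation
  exchanges the two Moebius values up to sign and inversion. The exchange identity restores the
  original order of the rotations.\<close>

lemma twisted_product_real:
  fixes a p z :: complex
  assumes p: "p \<noteq> 0" and z: "z \<noteq> 0" and a: "a \<noteq> 0"
    and b: "b = 1 / cnj a" and t: "t = - inverse (p * cnj p)"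
    and w: "w = (a * t - b) / (a - b * t)" "a * t \<noteq> b" "a \<noteq> b * t" "cnj w = w"
    and avoid: "z \<notin> {a, - a, b, - b}"
  defines "F \<equiv> \<lambda>z. U_rot (inverse w) ** frame_factor (w * p) ((b - z) / (b + z)) ** frame_factor p ((a - z) / (a + z))"
  shows "F z = conj_mat (F (1 / cnj z))"
proof -
  have w0: "w \<noteq> 0" unfolding w(1) using w(2,3) by simp
  have t0: "t \<noteq> 0" using p t by simp
  have F: "F x = U_rot p ** P_rot ((b - x) / (b + x)) ** U_rot (inverse w) ** P_rot ((a - x) / (a + x))
      ** U_rot (inverse p)" for x
  \<comment> \<open>Adjacent rotations about the first axis merge, leaving only
    \<open>U_rot (inverse w)\<close> between the two \<open>P_rot\<close> factors.\<close>
  proof -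
    let ?P = "P_rot ((b - x) / (b + x))" and ?P' = "P_rot ((a - x) / (a + x))"
    have "F x = (U_rot (inverse w) ** U_rot (w * p)) ** ?P ** (U_rot (inverse (w * p)) ** U_rot p) ** ?P'
      ** U_rot (inverse p)"
      by (simp only: F_def frame_factor_def matrix_mul_assoc)
    moreover have "inverse w * (w * p) = p" "inverse (w * p) * p = inverse w"
      using w0 p by (simp_all add: field_simps)
    ultimately show ?thesis using w0 p by (simp add: U_rot_mult del: inverse_mult_distrib)
  qed
  define m n where "m = (a - z) / (a + z)" and "n = (b - z) / (b + z)"
  have nz: "a + z \<noteq> 0" "a - z \<noteq> 0" "b + z \<noteq> 0" "b - z \<noteq> 0"
    using avoid moebius_denominators_nonzero[of z a] moebius_denominators_nonzero[of z b] by auto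
  have cm: "cnj ((b - 1 / cnj z) / (b + 1 / cnj z)) = - m"
  proof -
    have "cnj ((b - 1 / cnj z) / (b + 1 / cnj z)) = (1 / a - 1 / z) / (1 / a + 1 / z)" by (simp add: b)
    moreover have "1 / a - 1 / z = - (a - z) / (a * z)" "1 / a + 1 / z = (a + z) / (a * z)"
      using a z by (simp_all add: field_simps)
    ultimately show ?thesis using a z by (simp add: m_def minus_divide_left)
  qed
  have cn: "cnj ((a - 1 / cnj z) / (a + 1 / cnj z)) = - n"
  proof -
    have ca: "cnj a = 1 / b" "b \<noteq> 0" using b a by simp_all
    have "cnj ((a - 1 / cnj z) / (a + 1 / cnj z)) = (1 / b - 1 / z) / (1 / b + 1 / z)" by (simp add: ca)
    moreover have "1 / b - 1 / z = - (b - z) / (b * z)" "1 / b + 1 / z = (b + z) / (b * z)"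
      using ca z by (simp_all add: field_simps)
    ultimately show ?thesis using ca z by (simp add: n_def minus_divide_left)
  qed
  have ip: "inverse (cnj p) = p * t * (- 1)" "cnj p = - 1 * (inverse t * inverse p)"
    using p by (simp_all add: t field_simps)
  \<comment> \<open>The minus sign in \<open>t\<close> thus contributes a factor
    \<open>Q_mat\<close> at each end, and together these act as \<open>tau\<close>, which inverts
    the parameters of both \<open>P_rot\<close> factors.\<close>
  have Q: "U_rot (- 1) = Q_mat"
    by (simp add: U_rot_def Q_mat_def matrix3_simps ucos_def usin_def)
  \<comment> \<open>With D = diag(-1, -1, 1), a sign change of the parameter multiplies
    \<open>P_rot\<close> by D, and conjugation by D turns \<open>U_rot w\<close> into
    \<open>U_rot (inverse w)\<close>.\<close>
  have PUP: "P_rot (- m) ** U_rot w ** P_rot (- n) = P_rot m ** U_rot (inverse w) ** P_rot n"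
    by (simp add: matrix3_simps P_rot_def U_rot_def)
  have rotation_exchange': "P_rot n ** U_rot (inverse w) ** P_rot m ** U_rot t
      = U_rot t ** P_rot m ** U_rot (inverse w) ** P_rot n"
    using rotation_exchange[of z a b t] avoid t0 w by (simp add: m_def n_def)
  have "conj_mat (F (1 / cnj z)) = U_rot (inverse (cnj p)) ** P_rot (- inverse m) ** U_rot w
      ** P_rot (- inverse n) ** U_rot (cnj p)"
    unfolding F conj_mat_mult conj_mat_P_rot conj_mat_U_rot cm cn by (simp add: w(4))
  also have "\<dots> = U_rot p ** U_rot t ** (Q_mat ** P_rot (- inverse m) ** U_rot w
      ** P_rot (- inverse n) ** Q_mat) ** (U_rot (inverse t) ** U_rot (inverse p))"
  proof -
    have "U_rot (inverse (cnj p)) = U_rot p ** U_rot t ** Q_mat"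
      "U_rot (cnj p) = Q_mat ** (U_rot (inverse t) ** U_rot (inverse p))"
      unfolding ip Q[symmetric] using p t0 by (simp_all add: U_rot_mult mult.commute)
    then show ?thesis by (simp only: matrix_mul_assoc)
  qed
  also have "Q_mat ** P_rot (- inverse m) ** U_rot w ** P_rot (- inverse n) ** Q_mat
      = tau (P_rot (- inverse m) ** U_rot w ** P_rot (- inverse n))"
    by (simp only: tau_def matrix_mul_assoc)
  also have "\<dots> = P_rot m ** U_rot (inverse w) ** P_rot n"
    by (simp add: tau_mult tau_P_rot tau_U_rot PUP)
  also have "U_rot p ** U_rot t ** (P_rot m ** U_rot (inverse w) ** P_rot n) ** (U_rot (inverse t) ** U_rot (inverse p))
    = U_rot p ** (U_rot t ** P_rot m ** U_rot (inverse w) ** P_rot n) ** U_rot (inverse t) ** U_rot (inverse p)"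
    by (simp only: matrix_mul_assoc)
  \<comment> \<open>The exchange identity carries \<open>U_rot t\<close> to the right, where it
    meets its inverse.\<close>
  also have "\<dots> = U_rot p ** P_rot n ** U_rot (inverse w) ** P_rot m ** (U_rot t ** U_rot (inverse t)) ** U_rot (inverse p)"
    unfolding rotation_exchange'[symmetric] by (simp only: matrix_mul_assoc)
  also have "\<dots> = F z"
    using t0 by (simp add: U_rot_mult U_rot_1 F m_def n_def)
  finally show ?thesis by simp
qed

section \<open>Iwasawa normalisation and membership in the loop group\<close>

lemma frame_factor_1: "p \<noteq> 0 \<Longrightarrow> frame_factor p 1 = mat 1"
proof -
  have "P_rot 1 = mat 1" by (simp add: P_rot_def matrix3_simps ucos_def usin_def mat_def)
  then show "p \<noteq> 0 \<Longrightarrow> frame_factor p 1 = mat 1" by (simp add: frame_factor_def U_rot_mult U_rot_1)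
qed

lemma iwasawa_factor:
  assumes B: "iwasawa B" and g: "g \<in> KC_grp"
  shows "\<exists>u\<in>K_grp. transpose u ** g \<in> B"
proof -
  obtain h where "homeomorphism (K_grp \<times> B) KC_grp (\<lambda>(k, b). k ** b) h"
    using B by (auto simp: iwasawa_def)
  then have "(\<lambda>(k, b). k ** b) ` (K_grp \<times> B) = KC_grp" by (rule homeomorphism_image1)
  with g have "g \<in> (\<lambda>(k, b). k ** b) ` (K_grp \<times> B)" by simp
  then obtain u b where ub: "u \<in> K_grp" "b \<in> B" "g = u ** b" by auto
  then have "transpose u ** u = mat 1"
    by (simp add: K_grp_def SO3R_def SO3C_def orthogonal_matrix_def)
  then have "transpose u ** g \<in> B" using ub by (simp add: matrix_mul_assoc)
  with ub(1) show ?thesis by blast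
qed

lemma conj_mat_transpose_K: "u \<in> K_grp \<Longrightarrow> conj_mat (transpose u) = transpose u"
  by (simp add: K_grp_def SO3R_def conj_mat_def map_matrix_def transpose_def vec_eq_iff Reals_cnj_iff)

lemma KC_subset: "KC_grp \<subseteq> KtauC"
  using KC_rot rot_KC by blast

lemma iwasawa_subset: "iwasawa B \<Longrightarrow> B \<subseteq> KC_grp"
  using subgroup.subset[of B "mat_group KC_grp"] by (auto simp: iwasawa_def mat_group_def)

text \<open>Here \<open>t\<close> is a negative real number T and \<open>b\<close> is
  \<open>a\<close> times a positive real number X. The factor \<open>a\<close> cancels and leaves (T
  - X) / (1 - X T), whose numerator is negative and whose denominator is positive.\<close>

lemma reflection_parameter:
  fixes a p :: complex
  assumes "a \<noteq> 0" "p \<noteq> 0"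
  defines "b \<equiv> 1 / cnj a" and "t \<equiv> - inverse (p * cnj p)"
  shows "a * t \<noteq> b" "a \<noteq> b * t" "cnj ((a * t - b) / (a - b * t)) = (a * t - b) / (a - b * t)"
proof -
  define T X where "T = - inverse ((norm p)\<^sup>2)" and "X = inverse ((norm a)\<^sup>2)"
  have TX: "T < 0" "0 < X" using assms by (simp_all add: T_def X_def)
  have t: "t = of_real T" by (simp only: t_def T_def of_real_minus of_real_inverse complex_norm_square)
  have "of_real X = inverse (a * cnj a)" by (simp only: X_def of_real_inverse complex_norm_square)
  then have b: "b = a * of_real X" using assms(1) by (simp add: b_def field_simps)
  have XT: "X * T < 0" using TX by (simp add: mult_pos_neg)
  have 1: "a * t - b = a * of_real (T - X)" "a - b * t = a * of_real (1 - X * T)"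
    by (simp_all add: t b algebra_simps)
  have "T - X \<noteq> 0" "1 - X * T \<noteq> 0" using TX XT by auto
  then have "a * of_real (T - X) \<noteq> 0" "a * of_real (1 - X * T) \<noteq> 0"
    using assms(1) by (simp_all only: mult_eq_0_iff of_real_eq_0_iff simp_thms not_False_eq_True)
  then show "a * t \<noteq> b" "a \<noteq> b * t" using 1 by auto
  have "(a * t - b) / (a - b * t) = of_real ((T - X) / (1 - X * T))"
    unfolding 1 using assms(1) by simp
  then show "cnj ((a * t - b) / (a - b * t)) = (a * t - b) / (a - b * t)" by simp
qed

text \<open>All zeros and poles of the Moebius values lie strictly between the two circles, so the
  product itself is the required extension. At 0 both factors are the identity, which leaves
  \<open>M\<close> as the value.\<close>

lemma frame_factor_product_loop:
  fixes M :: "complex^3^3" and a b p q :: complex and \<epsilon> :: real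
  assumes e: "0 < \<epsilon>" "\<epsilon> < 1"
    and avoid: "\<And>z. z \<in> {a, - a, b, - b} \<Longrightarrow> \<epsilon> < norm z \<and> norm z < 1 / \<epsilon>"
    and M: "M \<in> B" "M \<in> KtauC" and pq: "p \<noteq> 0" "q \<noteq> 0"
  defines "G \<equiv> \<lambda>x. M ** frame_factor q (Defs.moebius b x) ** frame_factor p (Defs.moebius a x)"
  shows "(\<lambda>z\<in>circles \<epsilon>. G (Fin z)) \<in> loop_group_C \<epsilon> B"
proof -
  define R where "R = - {Fin a, Fin (- a), Fin b, Fin (- b)}"
  have R: "R \<inter> {Fin a, Fin (- a), Fin b, Fin (- b)} = {}" by (auto simp: R_def)
  have hol: "(\<lambda>z. G (Fin z) $ i $ j) holomorphic_on (Fin -` R)"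
    "(\<lambda>w. G (chart_inf w) $ i $ j) holomorphic_on (chart_inf -` R)" for i j
    unfolding G_def by (rule frame_factor_product_holomorphic[OF R])+
  have "x \<noteq> Fin z" if "x \<in> I_dom \<epsilon> \<union> Fin ` circles \<epsilon>" "z \<in> {a, - a, b, - b}" for x z
    using avoid[OF that(2)] that(1) by (auto simp: I_dom_def circles_def)
  then have sub: "I_dom \<epsilon> \<union> Fin ` circles \<epsilon> \<subseteq> R"
    unfolding R_def by blast
  have circ: "z \<in> circles \<epsilon> \<Longrightarrow> Fin z \<in> R" "z \<in> circles \<epsilon> \<Longrightarrow> - z \<in> circles \<epsilon>" for z
    using sub by (auto simp: circles_def)
  have MS: "M \<in> SO3C" "tau M = M" using M by (auto simp: KtauC_def)
  have GS: "G x \<in> SO3C" if "x \<in> R" for x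
    using that MS pq moebius_nonzero[of x a] moebius_nonzero[of x b]
    by (auto simp: G_def R_def intro!: SO3C_mult frame_factor_SO3C)
  have m0: "Defs.moebius c (Fin 0) = 1" if "c \<noteq> 0" for c using that by simp
  have "a \<noteq> 0" "b \<noteq> 0" using avoid[of a] avoid[of b] e by auto
  then have G0: "G (Fin 0) = M"
    using pq by (simp add: G_def m0 frame_factor_1 del: moebius.simps)
  have smooth: "smooth_curve (\<lambda>\<theta>. G (Fin (of_real r * cis \<theta>)))" if r: "r \<in> {\<epsilon>, 1 / \<epsilon>}" for r
  proof (rule smooth_curve_circle)
    show "(\<lambda>z. G (Fin z) $ i $ j) holomorphic_on Fin -` R" for i j by (rule hol)
    have "Fin -` R = - {a, - a, b, - b}" by (auto simp: R_def)
    then show "open (Fin -` R)" by (simp add: open_Compl finite_imp_closed)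
    show "of_real r * cis \<theta> \<in> Fin -` R" for \<theta>
      using r e circ(1)[of "of_real r * cis \<theta>"] by (auto simp: circles_def norm_mult)
  qed
  have smooth': "smooth_on_circles \<epsilon> (\<lambda>z\<in>circles \<epsilon>. G (Fin z))"
    unfolding smooth_on_circles_def
  proof
    fix r assume r: "r \<in> {\<epsilon>, 1 / \<epsilon>}"
    then have "of_real r * cis \<theta> \<in> circles \<epsilon>" for \<theta> using e by (auto simp: circles_def norm_mult)
    then show "smooth_curve (\<lambda>\<theta>. (\<lambda>z\<in>circles \<epsilon>. G (Fin z)) (of_real r * cis \<theta>))"
      using smooth[OF r] by simp
  qed
  \<comment> \<open>Replacing z by -z inverts the Moebius value, and so does
    \<open>tau\<close>.\<close>
  have tau: "tau (G (Fin z)) = G (Fin (- z))" for z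
    by (simp add: G_def tau_mult tau_frame_factor MS)
  have cont: "cp1_continuous_on (I_dom \<epsilon> \<union> Fin ` circles \<epsilon>) G"
    unfolding cp1_continuous_on_def o_def
    by (intro conjI continuous_on_holomorphic_entries holomorphic_on_subset[OF hol(1)] holomorphic_on_subset[OF hol(2)])
      (use sub in auto)
  have holo: "cp1_holomorphic_on (I_dom \<epsilon>) G"
    unfolding cp1_holomorphic_on_def
    by (intro conjI allI holomorphic_on_subset[OF hol(1)] holomorphic_on_subset[OF hol(2)])
      (use sub in auto)
  have "G ` I_dom \<epsilon> \<subseteq> SO3C" using GS sub by auto
  then have "\<exists>\<Gamma>. (\<forall>z\<in>circles \<epsilon>. \<Gamma> (Fin z) = (\<lambda>z\<in>circles \<epsilon>. G (Fin z)) z) \<and>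
             \<Gamma> ` I_dom \<epsilon> \<subseteq> SO3C \<and>
             cp1_continuous_on (I_dom \<epsilon> \<union> Fin ` circles \<epsilon>) \<Gamma> \<and>
             cp1_holomorphic_on (I_dom \<epsilon>) \<Gamma> \<and>
             \<Gamma> (Fin 0) \<in> B"
    using cont holo G0 M(1) by (intro exI[of _ G]) simp
  moreover have "(\<lambda>z\<in>circles \<epsilon>. G (Fin z)) \<in> circles \<epsilon> \<rightarrow>\<^sub>E SO3C"
    using GS circ(1) by auto
  ultimately show ?thesis
    unfolding loop_group_C_def using smooth' tau circ(2) by simp
qed

section \<open>Choice of the constant factor and of the radius\<close>

theorem theorem9:
  fixes B :: "(complex^3^3) set"
    and L L\<^sub>1 L\<^sub>2 L\<^sub>1' L\<^sub>2' :: "(complex^3) set"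
    and \<alpha> \<alpha>\<^sub>1 \<alpha>\<^sub>2 :: complex
  assumes "iwasawa B"
    and "isotropic_line L" and "mat_image Q_mat L \<noteq> L"
    and "\<alpha> \<noteq> 0"
    and "L\<^sub>1 = L" and "L\<^sub>2 = conj_vec ` L"
    and "\<alpha>\<^sub>1 = \<alpha>" and "\<alpha>\<^sub>2 = 1 / cnj \<alpha>\<^sub>1"
    and "\<alpha>\<^sub>1\<^sup>2 \<noteq> \<alpha>\<^sub>2\<^sup>2"
    and "L\<^sub>2' = mat_image (simple_factor \<alpha>\<^sub>1 L\<^sub>1 (Fin \<alpha>\<^sub>2)) L\<^sub>2"
    and "L\<^sub>1' = mat_image (simple_factor \<alpha>\<^sub>2 L\<^sub>2 (Fin \<alpha>\<^sub>1)) L\<^sub>1"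
    and "mat_image Q_mat L\<^sub>1' \<noteq> L\<^sub>1'" and "mat_image Q_mat L\<^sub>2' \<noteq> L\<^sub>2'"
  shows "\<exists>k\<in>KtauC. \<exists>\<epsilon>::real. 0 < \<epsilon> \<and> \<epsilon> < 1 \<and>
           circles \<epsilon> \<inter> {\<alpha>\<^sub>1, - \<alpha>\<^sub>1, \<alpha>\<^sub>2, - \<alpha>\<^sub>2} = {} \<and>
           (\<lambda>z\<in>circles \<epsilon>. k ** simple_factor \<alpha>\<^sub>2 L\<^sub>2' (Fin z) ** simple_factor \<alpha>\<^sub>1 L\<^sub>1 (Fin z))
             \<in> loop_group_R \<epsilon> B"
proof -
  obtain p where p: "p \<noteq> 0" and L: "L = line_of (iso_vec p)"
    using isotropic_line_eq assms(2,3) by blast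
  define t where "t = - inverse (p * cnj p)"
  define w where "w = (\<alpha> * t - \<alpha>\<^sub>2) / (\<alpha> - \<alpha>\<^sub>2 * t)"
  have b: "\<alpha>\<^sub>2 = 1 / cnj \<alpha>" using assms(7,8) by simp
  note par = reflection_parameter[OF assms(4) p, folded b t_def]
  have t0: "t \<noteq> 0" using p by (simp add: t_def)
  have w0: "w \<noteq> 0" using par(1,2) by (simp add: w_def)
  have ab: "\<alpha> \<noteq> \<alpha>\<^sub>2" "\<alpha> \<noteq> - \<alpha>\<^sub>2" using assms(7,9) by auto
  have "- inverse (cnj p) = t * p" using p by (simp add: t_def)
  then have L2: "L\<^sub>2 = line_of (iso_vec (t * p))"
    using assms(6) by (simp add: L conj_line_of conj_iso_vec)
  have sf1: "simple_factor \<alpha>\<^sub>1 L\<^sub>1 x = frame_factor p (Defs.moebius \<alpha> x)" for x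
    using simple_factor_eq[OF p] assms(5,7) L by simp
  obtain c where "c \<noteq> 0" "frame_factor p ((\<alpha> - \<alpha>\<^sub>2) / (\<alpha> + \<alpha>\<^sub>2)) *v iso_vec (t * p) = c *s iso_vec (w * p)"
    using frame_factor_iso_vec[OF p t0 ab par(1,2)] unfolding w_def by blast
  then have "L\<^sub>2' = line_of (iso_vec (w * p))"
    using assms(10) by (simp add: sf1 L2 mat_image_line_of line_of_scale)
  moreover have wp: "w * p \<noteq> 0" using w0 p by simp
  ultimately have sf2: "simple_factor \<alpha>\<^sub>2 L\<^sub>2' x = frame_factor (w * p) (Defs.moebius \<alpha>\<^sub>2 x)" for x
    using simple_factor_eq by simp
  \<comment> \<open>\<open>U_rot (inverse w)\<close> gives reality but need not lie in
    \<open>B\<close>; a real rotation on the left corrects this.\<close>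
  obtain u where u: "u \<in> K_grp" "transpose u ** U_rot (inverse w) \<in> B"
    using iwasawa_factor[OF assms(1) U_rot_KC[of "inverse w"]] w0 by auto
  define k where "k = transpose u ** U_rot (inverse w)"
  have kK: "k \<in> KtauC" using u(2) iwasawa_subset[OF assms(1)] KC_subset by (auto simp: k_def)
  define G where "G = (\<lambda>x. k ** frame_factor (w * p) (Defs.moebius \<alpha>\<^sub>2 x) ** frame_factor p (Defs.moebius \<alpha> x))"
  \<comment> \<open>As \<alpha> and \<open>\<alpha>\<^sub>2\<close> have reciprocal norms, half the
    smaller norm puts all four excluded points strictly inside the annulus.\<close>
  define \<epsilon> where "\<epsilon> = min (norm \<alpha>) (1 / norm \<alpha>) / 2"
  have a0: "norm \<alpha> > 0" using assms(4) by simp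
  have nb: "norm \<alpha>\<^sub>2 = 1 / norm \<alpha>" by (simp add: b norm_divide)
  have "min (norm \<alpha>) (1 / norm \<alpha>) \<le> 1"
    using a0 by (cases "norm \<alpha> \<le> 1") (auto simp: min_le_iff_disj)
  then have e: "0 < \<epsilon>" "\<epsilon> < 1" using a0 by (auto simp: \<epsilon>_def)
  have "\<epsilon> < norm \<alpha>" "\<epsilon> < 1 / norm \<alpha>"
    using a0 by (auto simp: \<epsilon>_def min_def field_simps)
  then have lt: "\<epsilon> < norm \<alpha>" "norm \<alpha> < 1 / \<epsilon>" "\<epsilon> < norm \<alpha>\<^sub>2" "norm \<alpha>\<^sub>2 < 1 / \<epsilon>"
    using a0 e(1) by (simp_all add: nb field_simps)
  then have avoid: "z \<in> {\<alpha>, - \<alpha>, \<alpha>\<^sub>2, - \<alpha>\<^sub>2} \<Longrightarrow> \<epsilon> < norm z \<and> norm z < 1 / \<epsilon>" for z by auto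
  then have disj: "circles \<epsilon> \<inter> {\<alpha>, - \<alpha>, \<alpha>\<^sub>2, - \<alpha>\<^sub>2} = {}" by (force simp: circles_def)
  have loop: "(\<lambda>z\<in>circles \<epsilon>. G (Fin z)) \<in> loop_group_C \<epsilon> B"
    unfolding G_def using frame_factor_product_loop[OF e avoid _ kK p wp] u(2) by (simp add: k_def)
  have real: "G (Fin z) = conj_mat (G (Fin (1 / cnj z)))" if z: "z \<in> circles \<epsilon>" for z
  proof -
    have z0: "z \<noteq> 0" using z e by (auto simp: circles_def)
    have za: "z \<notin> {\<alpha>, - \<alpha>, \<alpha>\<^sub>2, - \<alpha>\<^sub>2}" using z disj by blast
    have G: "G (Fin x) = transpose u ** (U_rot (inverse w) ** frame_factor (w * p) ((\<alpha>\<^sub>2 - x) / (\<alpha>\<^sub>2 + x))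
        ** frame_factor p ((\<alpha> - x) / (\<alpha> + x)))" for x
      by (simp add: G_def k_def matrix_mul_assoc)
    show ?thesis
      unfolding G conj_mat_mult[of "transpose u"] conj_mat_transpose_K[OF u(1)]
      using twisted_product_real[OF p z0 assms(4) b t_def w_def par(1,2) par(3)[folded w_def] za]
      by (rule arg_cong)
  qed
  have inv: "1 / cnj z \<in> circles \<epsilon>" if "z \<in> circles \<epsilon>" for z
    using that by (auto simp: circles_def norm_divide)
  have "(\<lambda>z\<in>circles \<epsilon>. G (Fin z)) z = conj_mat ((\<lambda>z\<in>circles \<epsilon>. G (Fin z)) (1 / cnj z))"
    if z: "z \<in> circles \<epsilon>" for z
    using z inv[OF z] by (simp add: real[OF z, symmetric])
  with loop have "(\<lambda>z\<in>circles \<epsilon>. G (Fin z)) \<in> loop_group_R \<epsilon> B"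
    unfolding loop_group_R_def by blast
  then show ?thesis
    using e kK disj assms(7) unfolding sf1 sf2 G_def by blast
qed

end
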